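(* Let $\mathcal{H}_1,\mathcal{H}_2$ be real or complex Hilbert spaces, $M\subseteq\mathcal{H}_1$ and $N\subseteq\mathcal{H}_2$ closed subspaces, and let $T\in\mathcal{B}(\mathcal{H}_1,\mathcal{H}_2)$ have block form $T=\begin{pmatrix}A&B\\C&D\end{pmatrix}$ with respect to $\mathcal{H}_1=M\oplus M^\perp$ and $\mathcal{H}_2=N\oplus N^\perp$. Assume that $T$ is $(M,N)$-complementable and let $X\in\mathcal{B}(M,M^\perp)$ be an operator satisfying $C=DX$. Let $S:M\to N$ denote the Schur complement $T_{/(M,N)}$ regarded as an operator from $M$ to $N$. Then: (1) The following are equivalent: (a) $\|Tx\|\ge\|T_{/(M,N)}x\|$ for every $x\in M$; (b) $C^*C+X^*B^*A+A^*BX-X^*B^*BX\ge 0$; (c) $C^*C+A^*A\ge S^*S$. (2) The following are equivalent: (a) $\|Tx\|\le\|T_{/(M,N)}x\|$ for every $x\in M$; (b) $C^*C+X^*B^*A+A^*BX-X^*B^*BX\le 0$; (c) $C^*C+A^*A\le S^*S$. (3) The following are equivalent: (a) $\|Tx\|=\|T_{/(M,N)}x\|$ for every $x\in M$; (b) $C^*C+X^*B^*A+A^*BX-X^*B^*BX=0$; (c) $C^*C+A^*A=S^*S$.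
   Context: $\mathcal{B}(\mathcal{H},\mathcal{K})$ is the space of bounded linear operators; $\mathcal{R}(\cdot)$ and $\mathcal{N}(\cdot)$ denote range and null space. Block entries: $A:M\to N$, $B:M^\perp\to N$, $C:M\to N^\perp$, $D:M^\perp\to N^\perp$, all bounded. $T$ is $(M,N)$-complementable if $\mathcal{R}(C)\subseteq\mathcal{R}(D)$ and $\mathcal{R}(B^* )\subseteq\mathcal{R}(D^* )$. If $\mathcal{R}(A_1)\subseteq\mathcal{R}(B_1)$ for bounded operators $A_1,B_1$ with the same codomain, the Douglas reduced solution of $A_1=B_1X$ is the unique bounded $C_1$ with $A_1=B_1C_1$ and $\mathcal{R}(C_1)\subseteq\mathcal{N}(B_1)^\perp$. For $(M,N)$-complementable $T$, the Schur complement is $T_{/(M,N)}=\begin{pmatrix}A-BZ&0\\0&0\end{pmatrix}=\begin{pmatrix}A-YC&0\\0&0\end{pmatrix}$, where $Z$ is the Douglas reduced solution of $C=DX$ and $Y^*$ is the Douglas reduced solution of $B^*=D^*X$. For self-adjoint operators on $M$, $P\ge Q$ means $\langle (P-Q)x,x\rangle\ge 0$ for all $x\in M$. A vector $x\in M$ is identified with $(x,0)\in M\oplus M^\perp$. *)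

theory Defs
  imports "HOL-Analysis.Analysis"
begin

(* Scalar fields.  From the last axiom and additivity, every x is a root of
   (X - x)(X - conjg x), whose coefficients are real; hence a field of this class is,
   up to isomorphism, either the reals (conjg = identity) or the complex numbers
   (conjg = cnj). *)
class real_or_complex = real_normed_field +
  fixes conjg :: "'a \<Rightarrow> 'a"
  assumes conjg_add: "conjg (x + y) = conjg x + conjg y"
    and conjg_mult: "conjg (x * y) = conjg x * conjg y"
    and mult_conjg: "x * conjg x = (norm x)\<^sup>2 *\<^sub>R 1"

instantiation real :: real_or_complex
begin
definition conjg_real :: "real \<Rightarrow> real" where "conjg_real x = x"
instance by standard (simp_all add: conjg_real_def power2_eq_square)
end

instantiation complex :: real_or_complex
begin
definition conjg_complex :: "complex \<Rightarrow> complex" where "conjg_complex x = cnj x"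
instance by standard (simp_all add: conjg_complex_def complex_norm_square[symmetric]
    scaleR_conv_of_real)
end

record ('k, 'h) inner_space =
  scl :: "'k \<Rightarrow> 'h \<Rightarrow> 'h"
  ip :: "'h \<Rightarrow> 'h \<Rightarrow> 'k"

(* The class banach supplies completeness, norm and topology; ip is linear in its first
   argument and induces the norm. *)
locale hilbert_space = vector_space "scl H"
  for H :: "('k::real_or_complex, 'h::banach) inner_space" +
  assumes scl_of_real: "scl H (of_real r) x = r *\<^sub>R x"
    and ip_add_left: "ip H (x + y) z = ip H x z + ip H y z"
    and ip_scl_left: "ip H (scl H c x) y = c * ip H x y"
    and ip_commute: "ip H y x = conjg (ip H x y)"
    and ip_self: "ip H x x = of_real ((norm x)\<^sup>2)"

lemma hilbert_space_real:
  "hilbert_space \<lparr>scl = scaleR, ip = (inner :: 'h::{real_inner,banach} \<Rightarrow> 'h \<Rightarrow> real)\<rparr>"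
  by unfold_locales
    (simp_all add: scaleR_add_right scaleR_add_left inner_add_left inner_add_right conjg_real_def
      inner_commute power2_norm_eq_inner)

lemma hilbert_space_complex:
  "hilbert_space \<lparr>scl = (*), ip = (\<lambda>x y :: complex. x * cnj y)\<rparr>"
  by unfold_locales
    (simp_all add: algebra_simps conjg_complex_def scaleR_conv_of_real
      complex_norm_square[symmetric])

definition closed_subspace :: "('k::real_or_complex, 'h::banach) inner_space \<Rightarrow> 'h set \<Rightarrow> bool" where
  "closed_subspace H M \<longleftrightarrow> module.subspace (scl H) M \<and> closed M"

definition orth :: "('k::real_or_complex, 'h::banach) inner_space \<Rightarrow> 'h set \<Rightarrow> 'h set" where
  "orth H M = {x. \<forall>y\<in>M. ip H x y = 0}"

definition proj :: "('k::real_or_complex, 'h::banach) inner_space \<Rightarrow> 'h set \<Rightarrow> 'h \<Rightarrow> 'h" where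
  "proj H M x = (THE m. m \<in> M \<and> x - m \<in> orth H M)"

(* The space B(M,N) for closed subspaces M of H and N of K.  An operator on M is
   represented by the function on the ambient type that vanishes off M, so that equality of
   operators is equality of functions.  Ranges and null spaces therefore always
   refer to the domain M, not to the whole type. *)
definition bop :: "('k::real_or_complex, 'a::banach) inner_space \<Rightarrow> 'a set \<Rightarrow>
    ('k, 'b::banach) inner_space \<Rightarrow> 'b set \<Rightarrow> ('a \<Rightarrow> 'b) set" where
  "bop H M K N = {F.
     (\<forall>x\<in>M. F x \<in> N) \<and>
     (\<forall>x\<in>M. \<forall>y\<in>M. F (x + y) = F x + F y) \<and>
     (\<forall>c. \<forall>x\<in>M. F (scl H c x) = scl K c (F x)) \<and>
     (\<exists>b. \<forall>x\<in>M. norm (F x) \<le> b * norm x) \<and>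
     (\<forall>x. x \<notin> M \<longrightarrow> F x = 0)}"

definition null_space :: "'a set \<Rightarrow> ('a \<Rightarrow> 'b::zero) \<Rightarrow> 'a set" where
  "null_space M F = {x \<in> M. F x = 0}"

definition adj :: "('k::real_or_complex, 'a::banach) inner_space \<Rightarrow> 'a set \<Rightarrow>
    ('k, 'b::banach) inner_space \<Rightarrow> 'b set \<Rightarrow> ('a \<Rightarrow> 'b) \<Rightarrow> 'b \<Rightarrow> 'a" where
  "adj H M K N F =
     (THE G. G \<in> bop K N H M \<and> (\<forall>x\<in>M. \<forall>y\<in>N. ip K (F x) y = ip H x (G y)))"

(* Block of T from M to N; the four blocks of T use M or orth H M, and N or orth K N. *)
definition block :: "'a set \<Rightarrow> ('k::real_or_complex, 'b::banach) inner_space \<Rightarrow> 'b set \<Rightarrow>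
    ('a \<Rightarrow> 'b) \<Rightarrow> 'a \<Rightarrow> 'b" where
  "block M K N T x = (if x \<in> M then proj K N (T x) else 0)"

(* Reduced solution X : L -> M of F = G X, where F : L -> N and G : M -> N. *)
definition douglas_reduced :: "('k::real_or_complex, 'c::banach) inner_space \<Rightarrow> 'c set \<Rightarrow>
    ('k, 'a::banach) inner_space \<Rightarrow> 'a set \<Rightarrow> ('c \<Rightarrow> 'b::zero) \<Rightarrow> ('a \<Rightarrow> 'b) \<Rightarrow> 'c \<Rightarrow> 'a" where
  "douglas_reduced J L H M F G =
     (THE X. X \<in> bop J L H M \<and> (\<forall>x\<in>L. F x = G (X x)) \<and> X ` L \<subseteq> orth H (null_space M G))"

definition complementable :: "('k::real_or_complex, 'a::banach) inner_space \<Rightarrow> 'a set \<Rightarrow>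
    ('k, 'b::banach) inner_space \<Rightarrow> 'b set \<Rightarrow> ('a \<Rightarrow> 'b) \<Rightarrow> bool" where
  "complementable H M K N T \<longleftrightarrow>
     (let B = block (orth H M) K N T;
          C = block M K (orth K N) T;
          D = block (orth H M) K (orth K N) T
      in C ` M \<subseteq> D ` orth H M \<and>
         adj H (orth H M) K N B ` N \<subseteq> adj H (orth H M) K (orth K N) D ` orth K N)"

(* The bounded operator on the whole of H whose only nonzero block is A - B Z. *)
definition schur_complement :: "('k::real_or_complex, 'a::banach) inner_space \<Rightarrow> 'a set \<Rightarrow>
    ('k, 'b::banach) inner_space \<Rightarrow> 'b set \<Rightarrow> ('a \<Rightarrow> 'b) \<Rightarrow> 'a \<Rightarrow> 'b" where
  "schur_complement H M K N T x =
     (let A = block M K N T;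
          B = block (orth H M) K N T;
          C = block M K (orth K N) T;
          D = block (orth H M) K (orth K N) T;
          Z = douglas_reduced H M H (orth H M) C D;
          m = proj H M x
      in A m - B (Z m))"

(* The order P \<le> Q of self-adjoint operators on M. *)
definition op_le :: "('k::real_or_complex, 'a::banach) inner_space \<Rightarrow> 'a set \<Rightarrow>
    ('a \<Rightarrow> 'a) \<Rightarrow> ('a \<Rightarrow> 'a) \<Rightarrow> bool" where
  "op_le H M P Q \<longleftrightarrow> (\<forall>x\<in>M. \<exists>r\<ge>0. ip H (Q x - P x) x = of_real r)"

end

theory Submission
  imports Defs
begin

text \<open>
  The restriction of \<open>T\<close> to \<open>M\<close> is the orthogonal sum of \<open>A\<close> and \<open>C\<close>, so for \<open>x\<close> in \<open>M\<close> the
  squared norm of \<open>T x\<close> is the quadratic form of \<open>C\<^sup>* C + A\<^sup>* A\<close>, while that of the Schur complement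
  is the form of \<open>S\<^sup>* S\<close>. Thus (a) and (c) say the same about the operator
  \<open>C\<^sup>* C + A\<^sup>* A - S\<^sup>* S\<close>, and it remains to see that this operator is the \<open>W\<close> of (b).

  The point is that \<open>S = A - B X\<close> for the given solution \<open>X\<close>, although \<open>S\<close> is defined through the
  reduced solution \<open>Z\<close> (lemma \<open>schur_complement_eq\<close>). Indeed \<open>Z\<close> is \<open>X\<close> minus its component in the
  null space of \<open>D\<close> (\<open>douglas_reduced_eq\<close>), and the inclusion of the range of \<open>B\<^sup>*\<close> in that of \<open>D\<^sup>*\<close>
  makes \<open>B\<close> vanish on this null space (\<open>null_space_mono_of_adj_range\<close>). Expanding
  \<open>(A - B X)\<^sup>* (A - B X)\<close> then gives \<open>W = C\<^sup>* C + A\<^sup>* A - S\<^sup>* S\<close>.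

  The two order statements follow directly. For the equality statement, equal norms only say that
  the quadratic form of \<open>W\<close> vanishes, which over the reals determines \<open>W\<close> only because the form is
  hermitian; \<open>ip_eq_of_norm_eq\<close> does this polarization uniformly in the scalar field.

  Projections, the Riesz representation and adjoints are derived for \<open>hilbert_space\<close>
  from the parallelogram law.
\<close>

section \<open>Scalars\<close>

lemma conjg_0 [simp]: "conjg (0::'k::real_or_complex) = 0"
  using conjg_add[of "0::'k" 0] by simp

lemma conjg_minus: "conjg (- x) = - conjg (x::'k::real_or_complex)"
  using conjg_add[of x "- x"] by (simp add: eq_neg_iff_add_eq_0 add.commute)

lemma conjg_diff: "conjg (x - y) = conjg x - conjg (y::'k::real_or_complex)"
  using conjg_add[of x "- y"] by (simp add: conjg_minus)

lemma mult_conjg_of_real: "x * conjg x = of_real ((norm (x::'k::real_or_complex))\<^sup>2)"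
  by (simp only: mult_conjg of_real_def)

lemma norm_conjg: "norm (conjg (x::'k::real_or_complex)) = norm x"
proof (cases "x = 0")
  case False
  have "norm (x * conjg x) = (norm x)\<^sup>2"
    by (simp only: mult_conjg_of_real norm_of_real) simp
  then show ?thesis using False by (simp add: norm_mult power2_eq_square)
qed simp

lemma conjg_conjg [simp]: "conjg (conjg (x::'k::real_or_complex)) = x"
proof (cases "x = 0")
  case False
  have "conjg x * conjg (conjg x) = conjg x * x"
    by (metis mult_conjg_of_real norm_conjg mult.commute)
  moreover have "conjg x \<noteq> 0" using False norm_conjg[of x] by auto
  ultimately show ?thesis by simp
qed simp

lemma conjg_of_real [simp]: "conjg (of_real r) = (of_real r :: 'k::real_or_complex)"
proof (cases "r = 0")
  case False
  have "of_real r * conjg (of_real r :: 'k) = of_real r * of_real r"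
    by (subst mult_conjg_of_real) (simp add: power2_eq_square)
  then show ?thesis using False by simp
qed simp

section \<open>Elementary inner product geometry\<close>

context hilbert_space
begin

lemma scl_neg1: "scl H (- 1) x = - x"
  using scl_of_real[of "- 1" x] by simp

lemma ip_0_left [simp]: "ip H 0 y = 0"
  using ip_add_left[of 0 0 y] by simp

lemma ip_minus_left: "ip H (- x) y = - ip H x y"
  using ip_scl_left[of "- 1" x y] by (simp add: scl_neg1)

lemma ip_diff_left: "ip H (x - y) z = ip H x z - ip H y z"
  using ip_add_left[of x "- y" z] by (simp add: ip_minus_left)

lemma ip_add_right: "ip H z (x + y) = ip H z x + ip H z y"
  by (metis ip_commute ip_add_left conjg_add)

lemma ip_scl_right: "ip H y (scl H c x) = conjg c * ip H y x"
  by (metis ip_commute ip_scl_left conjg_mult)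

lemma ip_0_right [simp]: "ip H y 0 = 0"
  by (metis ip_commute ip_0_left conjg_0)

lemma ip_diff_right: "ip H z (x - y) = ip H z x - ip H z y"
  by (metis ip_commute ip_diff_left conjg_diff)

lemma ip_eq_0_commute: "ip H x y = 0 \<longleftrightarrow> ip H y x = 0"
  by (metis ip_commute conjg_0)

lemma ip_self_eq_0 [simp]: "ip H x x = 0 \<longleftrightarrow> x = 0"
  by (simp add: ip_self)

lemma pythagoras:
  assumes "ip H x y = 0"
  shows "(norm (x + y))\<^sup>2 = (norm x)\<^sup>2 + (norm y)\<^sup>2"
proof -
  have "ip H y x = 0" using assms ip_eq_0_commute by blast
  then have "ip H (x + y) (x + y) = ip H x x + ip H y y"
    by (simp add: ip_add_left ip_add_right assms)
  then have "(of_real ((norm (x + y))\<^sup>2) :: 'k) = of_real ((norm x)\<^sup>2 + (norm y)\<^sup>2)"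
    unfolding ip_self of_real_add .
  then show ?thesis by (simp only: of_real_eq_iff)
qed

lemma parallelogram:
  fixes x y :: 'h
  shows "(norm (x + y))\<^sup>2 + (norm (x - y))\<^sup>2 = 2 * (norm x)\<^sup>2 + 2 * (norm y)\<^sup>2"
proof -
  have "ip H (x + y) (x + y) + ip H (x - y) (x - y) = 2 * ip H x x + 2 * ip H y y"
    by (simp add: ip_add_left ip_add_right ip_diff_left ip_diff_right)
  then have "(of_real ((norm (x + y))\<^sup>2 + (norm (x - y))\<^sup>2) :: 'k)
      = of_real (2 * (norm x)\<^sup>2 + 2 * (norm y)\<^sup>2)"
    unfolding ip_self by simp
  then show ?thesis by (simp only: of_real_eq_iff)
qed

text \<open>Pythagoras for the orthogonal splitting of \<open>u\<close> along the line through \<open>y\<close>. Nonnegativity of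
  the left-hand side is the Cauchy-Schwarz inequality; minimality of \<open>norm u\<close> among all \<open>u - c y\<close>
  forces the subtracted term to vanish, which is how a nearest point yields orthogonality.\<close>

lemma norm_minus_component:
  assumes "y \<noteq> 0"
  shows "(norm (u - scl H (ip H u y / of_real ((norm y)\<^sup>2)) y))\<^sup>2
    = (norm u)\<^sup>2 - (norm (ip H u y))\<^sup>2 / (norm y)\<^sup>2"
proof -
  define c where "c = ip H u y / of_real ((norm y)\<^sup>2)"
  have cy: "ip H (u - scl H c y) (scl H c y) = 0"
    using assms by (simp add: ip_scl_right ip_diff_left ip_scl_left c_def ip_self)
  have "ip H (scl H c y) (scl H c y) = (c * conjg c) * ip H y y"
    by (simp add: ip_scl_left ip_scl_right algebra_simps)
  then have "(of_real ((norm (scl H c y))\<^sup>2) :: 'k) = of_real ((norm c)\<^sup>2 * (norm y)\<^sup>2)"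
    unfolding ip_self mult_conjg_of_real of_real_mult .
  then have "(norm (scl H c y))\<^sup>2 = (norm c)\<^sup>2 * (norm y)\<^sup>2"
    by (simp only: of_real_eq_iff)
  also have "norm c = norm (ip H u y) / (norm y)\<^sup>2"
    by (simp add: c_def norm_divide norm_power)
  finally have n: "(norm (scl H c y))\<^sup>2 = (norm (ip H u y))\<^sup>2 / (norm y)\<^sup>2"
    using assms by (simp add: field_simps power2_eq_square)
  show ?thesis
    using pythagoras[OF cy] n unfolding c_def by simp
qed

lemma cauchy_schwarz: "norm (ip H x y) \<le> norm x * norm y"
proof (cases "y = 0")
  case False
  have "0 \<le> (norm x)\<^sup>2 - (norm (ip H x y))\<^sup>2 / (norm y)\<^sup>2"
    unfolding norm_minus_component[OF False, symmetric] by (rule zero_le_power2)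
  then have "(norm (ip H x y))\<^sup>2 / (norm y)\<^sup>2 \<le> (norm x)\<^sup>2" by linarith
  then have "(norm (ip H x y))\<^sup>2 \<le> (norm x * norm y)\<^sup>2"
    using False by (simp add: pos_divide_le_eq power_mult_distrib)
  then show ?thesis by (rule power2_le_imp_le) simp
qed simp

section \<open>Closed subspaces and orthogonal projection\<close>

lemma closed_subspace_intros:
  assumes "closed_subspace H M"
  shows closed_subspace_0: "0 \<in> M"
    and closed_subspace_add: "\<And>x y. x \<in> M \<Longrightarrow> y \<in> M \<Longrightarrow> x + y \<in> M"
    and closed_subspace_diff: "\<And>x y. x \<in> M \<Longrightarrow> y \<in> M \<Longrightarrow> x - y \<in> M"
    and closed_subspace_scl: "\<And>c x. x \<in> M \<Longrightarrow> scl H c x \<in> M"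
proof -
  have M: "subspace M" using assms by (simp only: closed_subspace_def)
  show "0 \<in> M" by (rule subspace_0[OF M])
  show "x + y \<in> M" "x - y \<in> M" if "x \<in> M" "y \<in> M" for x y
    using subspace_add[OF M that] subspace_diff[OF M that] .
  show "scl H c x \<in> M" if "x \<in> M" for c x by (rule subspace_scale[OF M that])
qed

lemma closed_subspace_UNIV: "closed_subspace H UNIV"
  by (simp add: closed_subspace_def)

text \<open>The target carries its own scalar multiplication \<open>s\<close>, so that the lemma covers operators
  between Hilbert spaces as well as scalar-valued functionals.\<close>

lemma closed_subspace_kernel:
  fixes g :: "'h \<Rightarrow> 'v::real_normed_vector" and s :: "'k \<Rightarrow> 'v \<Rightarrow> 'v"
  assumes M: "closed_subspace H M"
    and add: "\<And>x y. x \<in> M \<Longrightarrow> y \<in> M \<Longrightarrow> g (x + y) = g x + g y"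
    and scl: "\<And>c x. x \<in> M \<Longrightarrow> g (scl H c x) = s c (g x)" and s0: "\<And>c. s c 0 = 0"
    and bd: "\<And>x. x \<in> M \<Longrightarrow> norm (g x) \<le> b * norm x"
  shows "closed_subspace H {x\<in>M. g x = 0}"
proof -
  note mem = closed_subspace_intros[OF M]
  have g0: "g 0 = 0" using add[OF mem(1) mem(1)] by simp
  have "subspace {x\<in>M. g x = 0}"
    by (rule subspaceI) (auto simp: mem g0 add scl s0)
  moreover have "closed {x\<in>M. g x = 0}"
    unfolding closed_sequential_limits
  proof (intro allI impI, elim conjE)
    fix f l assume f: "\<forall>n::nat. f n \<in> {x\<in>M. g x = 0}" and lim: "f \<longlonglongrightarrow> l"
    have l: "l \<in> M"
      using M f lim unfolding closed_subspace_def closed_sequential_limits by blast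
    have "norm (g l) \<le> b * norm (l - f n)" for n
    proof -
      have "g ((l - f n) + f n) = g (l - f n) + g (f n)"
        using f l mem by (intro add) auto
      then have "g l = g (l - f n)" using f by simp
      then show ?thesis using bd[of "l - f n"] f l mem by auto
    qed
    moreover have "(\<lambda>n. b * norm (l - f n)) \<longlonglongrightarrow> b * norm (l - l)"
      by (intro tendsto_intros lim)
    ultimately have "norm (g l) \<le> b * norm (l - l)"
      by (intro LIMSEQ_le_const) auto
    then show "l \<in> {x\<in>M. g x = 0}" using l by simp
  qed
  ultimately show ?thesis by (simp add: closed_subspace_def)
qed

lemma closed_subspace_ip_kernel: "closed_subspace H {x. ip H x y = 0}"
proof -
  have "closed_subspace H {x\<in>UNIV. ip H x y = 0}"
  proof (rule closed_subspace_kernel[OF closed_subspace_UNIV])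
    show "norm (ip H x y) \<le> norm y * norm x" for x
      using cauchy_schwarz[of x y] by (simp only: mult.commute)
  qed (rule ip_add_left ip_scl_left mult_zero_right)+
  then show ?thesis by simp
qed

lemma closed_subspace_orth: "closed_subspace H (orth H M)"
proof -
  have eq: "orth H M = (\<Inter>y\<in>M. {x. ip H x y = 0})"
    by (auto simp: orth_def)
  have ker: "subspace {x. ip H x y = 0}" "closed {x. ip H x y = 0}" for y
    using closed_subspace_ip_kernel[of y] by (simp_all only: closed_subspace_def)
  have "subspace (orth H M)"
    unfolding eq by (rule subspace_Inter) (use ker(1) in blast)
  moreover have "closed (orth H M)"
    unfolding eq by (intro closed_INT ballI ker(2))
  ultimately show ?thesis by (simp only: closed_subspace_def)
qed

lemma orthD: "x \<in> orth H M \<Longrightarrow> y \<in> M \<Longrightarrow> ip H x y = 0"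
  by (simp add: orth_def)

lemma orthD': "x \<in> orth H M \<Longrightarrow> y \<in> M \<Longrightarrow> ip H y x = 0"
  using orthD ip_eq_0_commute by blast

lemma orth_Int: "x \<in> M \<Longrightarrow> x \<in> orth H M \<Longrightarrow> x = 0"
  using orthD by force

lemma subset_orth_orth: "M \<subseteq> orth H (orth H M)"
  using orthD' by (auto simp: orth_def)

text \<open>The projection theorem. By the parallelogram law, two points of \<open>M\<close> that almost realise the
  distance from \<open>x\<close> to \<open>M\<close> have a midpoint that cannot be much closer to \<open>x\<close>, so they are close
  to each other. A minimising sequence is therefore Cauchy, and its limit is the foot.\<close>

lemma projection_exists:
  assumes M: "closed_subspace H M"
  shows "\<exists>m\<in>M. x - m \<in> orth H M"
proof -
  note mem = closed_subspace_intros[OF M]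
  define Q where "Q = (\<lambda>m. (norm (x - m))\<^sup>2) ` M"
  define d where "d = Inf Q"
  have ne: "Q \<noteq> {}" using mem(1) by (auto simp: Q_def)
  have bdd: "bdd_below Q" by (auto simp: Q_def intro!: bdd_belowI[of _ 0])
  have dle: "d \<le> (norm (x - m))\<^sup>2" if "m \<in> M" for m
    unfolding d_def using bdd that by (intro cInf_lower) (auto simp: Q_def)
  have "\<exists>m\<in>M. (norm (x - m))\<^sup>2 < d + e" if "e > 0" for e
    using cInf_lessD[OF ne, of "d + e"] that by (auto simp: d_def Q_def)
  then have "\<forall>n::nat. \<exists>m\<in>M. (norm (x - m))\<^sup>2 < d + inverse (real (Suc n))"
    by simp
  then obtain f where fM: "\<And>n::nat. f n \<in> M"
    and fd: "\<And>n. (norm (x - f n))\<^sup>2 < d + inverse (real (Suc n))"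
    by metis
  have close: "(norm (f i - f j))\<^sup>2 \<le> 2 * inverse (real (Suc i)) + 2 * inverse (real (Suc j))"
    for i j
  proof -
    define m where "m = (1/2) *\<^sub>R (f i + f j)"
    have "m \<in> M"
      unfolding m_def using mem(4)[OF mem(2)[OF fM fM], of "of_real (1/2)" i j]
      by (simp only: scl_of_real)
    have "(x - f i) + (x - f j) = 2 *\<^sub>R (x - m)"
      by (simp add: m_def algebra_simps scaleR_2)
    then have "(norm ((x - f i) + (x - f j)))\<^sup>2 = 4 * (norm (x - m))\<^sup>2"
      by (simp add: power_mult_distrib)
    moreover have "norm ((x - f i) - (x - f j)) = norm (f i - f j)"
      by (simp add: norm_minus_commute)
    ultimately show ?thesis
      using parallelogram[of "x - f i" "x - f j"] dle[OF \<open>m \<in> M\<close>] fd[of i] fd[of j] by simp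
  qed
  have "Cauchy f"
  proof (rule metric_CauchyI)
    fix e :: real assume e: "e > 0"
    obtain n where n: "inverse (real (Suc n)) < e\<^sup>2 / 4"
      using reals_Archimedean[of "e\<^sup>2 / 4"] e by auto
    have "dist (f i) (f j) < e" if "i \<ge> n" "j \<ge> n" for i j
    proof -
      have "inverse (real (Suc i)) \<le> inverse (real (Suc n))"
        "inverse (real (Suc j)) \<le> inverse (real (Suc n))"
        using that by (auto intro!: le_imp_inverse_le)
      then have "(norm (f i - f j))\<^sup>2 < e\<^sup>2" using close[of i j] n by linarith
      then show ?thesis using e by (simp add: dist_norm power2_less_imp_less)
    qed
    then show "\<exists>N. \<forall>i\<ge>N. \<forall>j\<ge>N. dist (f i) (f j) < e" by blast
  qed
  then obtain m where lim: "f \<longlonglongrightarrow> m"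
    using Cauchy_convergent_iff convergent_def by blast
  have mM: "m \<in> M"
    using M fM lim unfolding closed_subspace_def closed_sequential_limits by blast
  have "(\<lambda>n. (norm (x - f n))\<^sup>2) \<longlonglongrightarrow> (norm (x - m))\<^sup>2"
    by (intro tendsto_intros lim)
  moreover have "(\<lambda>n. d + inverse (real (Suc n))) \<longlonglongrightarrow> d + 0"
    by (intro tendsto_intros LIMSEQ_inverse_real_of_nat)
  ultimately have le: "(norm (x - m))\<^sup>2 \<le> d"
    using fd by (intro LIMSEQ_le[of _ "(norm (x - m))\<^sup>2" _ d]) (auto intro: less_imp_le)
  have "ip H (x - m) y = 0" if y: "y \<in> M" for y
  proof (cases "y = 0")
    case False
    define c where "c = ip H (x - m) y / of_real ((norm y)\<^sup>2)"
    have "d \<le> (norm (x - m - scl H c y))\<^sup>2"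
      using dle[of "m + scl H c y"] mM y mem by (simp add: algebra_simps)
    then have "(norm (ip H (x - m) y))\<^sup>2 / (norm y)\<^sup>2 \<le> 0"
      using norm_minus_component[OF False, of "x - m"] le unfolding c_def by linarith
    then show ?thesis using False by (simp add: divide_le_0_iff)
  qed simp
  then show ?thesis using mM by (auto simp: orth_def)
qed

lemma proj_eqI:
  assumes M: "closed_subspace H M" and "m \<in> M" "x - m \<in> orth H M"
  shows "proj H M x = m"
  unfolding proj_def
proof (rule the_equality)
  fix m' assume m': "m' \<in> M \<and> x - m' \<in> orth H M"
  have "(x - m) - (x - m') \<in> orth H M"
    using m' assms closed_subspace_diff[OF closed_subspace_orth] by blast
  moreover have "(x - m) - (x - m') = m' - m" by (simp add: algebra_simps)
  ultimately have "m' - m = 0"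
    using orth_Int closed_subspace_diff[OF M] m' assms(2) by metis
  then show "m' = m" by simp
qed (intro conjI assms)

lemma
  assumes M: "closed_subspace H M"
  shows proj_in: "proj H M x \<in> M" and diff_proj_orth: "x - proj H M x \<in> orth H M"
proof -
  obtain m where m: "m \<in> M" "x - m \<in> orth H M" using projection_exists[OF M] by blast
  then show "proj H M x \<in> M" "x - proj H M x \<in> orth H M" unfolding proj_eqI[OF M m] .
qed

lemma proj_add:
  assumes M: "closed_subspace H M"
  shows "proj H M (x + y) = proj H M x + proj H M y"
proof (rule proj_eqI[OF M])
  have "(x - proj H M x) + (y - proj H M y) \<in> orth H M"
    by (intro closed_subspace_add[OF closed_subspace_orth] diff_proj_orth M)
  then show "x + y - (proj H M x + proj H M y) \<in> orth H M"
    by (simp add: algebra_simps)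
qed (intro closed_subspace_add[OF M] proj_in M)

lemma proj_scl:
  assumes M: "closed_subspace H M"
  shows "proj H M (scl H c x) = scl H c (proj H M x)"
proof (rule proj_eqI[OF M])
  have "scl H c (x - proj H M x) \<in> orth H M"
    by (intro closed_subspace_scl[OF closed_subspace_orth] diff_proj_orth M)
  then show "scl H c x - scl H c (proj H M x) \<in> orth H M"
    by (simp add: scale_right_diff_distrib)
qed (intro closed_subspace_scl[OF M] proj_in M)

lemma norm_proj_pythagoras:
  assumes M: "closed_subspace H M"
  shows "(norm x)\<^sup>2 = (norm (proj H M x))\<^sup>2 + (norm (x - proj H M x))\<^sup>2"
  using pythagoras[OF orthD'[OF diff_proj_orth[OF M] proj_in[OF M]], of x x] by simp

lemma norm_proj_le:
  assumes M: "closed_subspace H M"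
  shows "norm (proj H M x) \<le> norm x"
  by (rule power2_le_imp_le) (simp_all add: norm_proj_pythagoras[OF M, of x])

lemma norm_diff_proj_le:
  assumes M: "closed_subspace H M"
  shows "norm (x - proj H M x) \<le> norm x"
  by (rule power2_le_imp_le) (simp_all add: norm_proj_pythagoras[OF M, of x])

lemma proj_orth:
  assumes M: "closed_subspace H M"
  shows "proj H (orth H M) x = x - proj H M x"
proof (rule proj_eqI[OF closed_subspace_orth diff_proj_orth[OF M]])
  show "x - (x - proj H M x) \<in> orth H (orth H M)"
    using subset_orth_orth proj_in[OF M, of x] by auto
qed

lemma proj_id: "closed_subspace H M \<Longrightarrow> x \<in> M \<Longrightarrow> proj H M x = x"
  by (rule proj_eqI) (auto simp: closed_subspace_0[OF closed_subspace_orth])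

text \<open>Riesz representation. The kernel \<open>K\<close> of \<open>f\<close> in \<open>M\<close> is a closed subspace of codimension at
  most one, so the component \<open>u\<close> orthogonal to \<open>K\<close> of any vector outside \<open>K\<close> spans the rest
  of \<open>M\<close>; a suitable multiple of \<open>u\<close> represents \<open>f\<close>.\<close>

lemma riesz:
  fixes f :: "'h \<Rightarrow> 'k"
  assumes M: "closed_subspace H M"
    and add: "\<And>x y. x \<in> M \<Longrightarrow> y \<in> M \<Longrightarrow> f (x + y) = f x + f y"
    and scl: "\<And>c x. x \<in> M \<Longrightarrow> f (scl H c x) = c * f x"
    and bd: "\<And>x. x \<in> M \<Longrightarrow> norm (f x) \<le> b * norm x"
  shows "\<exists>g\<in>M. \<forall>x\<in>M. f x = ip H x g"
proof (cases "\<forall>x\<in>M. f x = 0")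
  case True
  then show ?thesis by (intro bexI[of _ 0] closed_subspace_0[OF M]) simp
next
  case False
  then obtain z where z: "z \<in> M" "f z \<noteq> 0" by blast
  note mem = closed_subspace_intros[OF M]
  define K where "K = {x\<in>M. f x = 0}"
  have K: "closed_subspace H K"
    unfolding K_def by (rule closed_subspace_kernel[OF M add scl _ bd]) auto
  define u where "u = z - proj H K z"
  have u: "u \<in> M" "u \<in> orth H K"
    using z mem diff_proj_orth[OF K, of z] proj_in[OF K, of z] by (auto simp: u_def K_def)
  have fdiff: "f (x - y) = f x - f y" if "x \<in> M" "y \<in> M" for x y
    using add[of "x - y" y] mem that by simp
  have fu: "f u = f z"
    using proj_in[OF K, of z] z by (simp add: u_def fdiff K_def)
  have un: "u \<noteq> 0" using fu z add[OF mem(1) mem(1)] by auto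
  define g where "g = scl H (conjg (f u) / of_real ((norm u)\<^sup>2)) u"
  have "f x = ip H x g" if x: "x \<in> M" for x
  proof -
    have "x - scl H (f x / f u) u \<in> K"
      using x u mem z fu by (simp add: K_def fdiff scl)
    then have "ip H (x - scl H (f x / f u) u) u = 0" by (rule orthD'[OF u(2)])
    then have xu: "ip H x u = (f x / f u) * of_real ((norm u)\<^sup>2)"
      by (simp only: ip_diff_left ip_scl_left ip_self right_minus_eq)
    have coeff: "conjg (conjg (f u) / of_real ((norm u)\<^sup>2)) * of_real ((norm u)\<^sup>2) = f u"
    proof -
      have "conjg (conjg (f u) / of_real ((norm u)\<^sup>2)) * conjg (of_real ((norm u)\<^sup>2))
          = conjg (conjg (f u) / of_real ((norm u)\<^sup>2) * of_real ((norm u)\<^sup>2))"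
        by (rule conjg_mult[symmetric])
      also have "\<dots> = f u" using un by simp
      finally show ?thesis by (simp only: conjg_of_real)
    qed
    have "ip H x g = (f x / f u)
        * (conjg (conjg (f u) / of_real ((norm u)\<^sup>2)) * of_real ((norm u)\<^sup>2))"
      unfolding g_def ip_scl_right xu by (rule mult.left_commute)
    also have "\<dots> = f x" unfolding coeff using z fu by simp
    finally show ?thesis by (rule sym)
  qed
  moreover have "g \<in> M" unfolding g_def by (intro mem u)
  ultimately show ?thesis by blast
qed

end

section \<open>Bounded operators between subspaces\<close>

lemma bopD:
  assumes "F \<in> bop H M K N"
  shows bop_in: "\<And>x. x \<in> M \<Longrightarrow> F x \<in> N"
    and bop_add: "\<And>x y. x \<in> M \<Longrightarrow> y \<in> M \<Longrightarrow> F (x + y) = F x + F y"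
    and bop_scl: "\<And>c x. x \<in> M \<Longrightarrow> F (scl H c x) = scl K c (F x)"
    and bop_off: "\<And>x. x \<notin> M \<Longrightarrow> F x = 0"
  using assms by (auto simp: bop_def)

lemma bop_bound:
  assumes "F \<in> bop H M K N"
  obtains b where "b \<ge> 0" "\<And>x. x \<in> M \<Longrightarrow> norm (F x) \<le> b * norm x"
proof -
  obtain b where b: "\<forall>x\<in>M. norm (F x) \<le> b * norm x"
    using assms by (auto simp: bop_def)
  have "norm (F x) \<le> max b 0 * norm x" if "x \<in> M" for x
    using b that mult_right_mono[of b "max b 0" "norm x"] by force
  then show ?thesis using that[of "max b 0"] by simp
qed

lemma bopI:
  assumes "\<And>x. x \<in> M \<Longrightarrow> F x \<in> N"
    and "\<And>x y. x \<in> M \<Longrightarrow> y \<in> M \<Longrightarrow> F (x + y) = F x + F y"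
    and "\<And>c x. x \<in> M \<Longrightarrow> F (scl H c x) = scl K c (F x)"
    and "\<And>x. x \<in> M \<Longrightarrow> norm (F x) \<le> b * norm x"
    and "\<And>x. x \<notin> M \<Longrightarrow> F x = 0"
  shows "F \<in> bop H M K N"
  using assms unfolding bop_def by blast

lemma bop_diff:
  assumes "hilbert_space H" "closed_subspace H M" "F \<in> bop H M K N" "x \<in> M" "y \<in> M"
  shows "F (x - y) = F x - F y"
  using bop_add[OF assms(3), of "x - y" y] assms(4,5)
    hilbert_space.closed_subspace_diff[OF assms(1,2)] by simp

lemma closed_subspace_null_space:
  assumes H: "hilbert_space H" and K: "hilbert_space K" and M: "closed_subspace H M"
    and F: "F \<in> bop H M K N"
  shows "closed_subspace H (null_space M F)"
proof -
  interpret K: hilbert_space K by (rule K)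
  obtain b where b: "\<And>x. x \<in> M \<Longrightarrow> norm (F x) \<le> b * norm x" using bop_bound[OF F] by metis
  show ?thesis unfolding null_space_def
    by (rule hilbert_space.closed_subspace_kernel[OF H M, where s = "scl K" and b = b])
      (auto simp: bopD[OF F] b)
qed

lemma block_in_bop:
  assumes H: "hilbert_space H" and K: "hilbert_space K"
    and M: "closed_subspace H M" and N: "closed_subspace K N"
    and T: "T \<in> bop H UNIV K UNIV"
  shows "block M K N T \<in> bop H M K N"
proof -
  interpret H: hilbert_space H by (rule H)
  interpret K: hilbert_space K by (rule K)
  obtain b where b: "\<And>x. norm (T x) \<le> b * norm x" using bop_bound[OF T] by (metis UNIV_I)
  show ?thesis
    by (rule bopI[where b = b])
      (auto simp: block_def K.proj_in[OF N] bopD[OF T] K.proj_add[OF N] K.proj_scl[OF N]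
        H.closed_subspace_intros[OF M] intro: order_trans[OF K.norm_proj_le[OF N] b])
qed

text \<open>The adjoint is the Riesz representative of \<open>x \<mapsto> ip K (F x) y\<close>, chosen for each \<open>y\<close>.
  Its linearity in \<open>y\<close> follows because a vector of \<open>M\<close> is determined by its inner products with
  \<open>M\<close>, its bound by testing the representative against itself.\<close>

lemma adjoint_exists:
  assumes H: "hilbert_space H" and K: "hilbert_space K"
    and M: "closed_subspace H M" and N: "closed_subspace K N"
    and F: "F \<in> bop H M K N"
  shows "\<exists>G \<in> bop K N H M. \<forall>x\<in>M. \<forall>y\<in>N. ip K (F x) y = ip H x (G y)"
proof -
  interpret H: hilbert_space H by (rule H)
  interpret K: hilbert_space K by (rule K)
  obtain b where b0: "b \<ge> 0" and b: "\<And>x. x \<in> M \<Longrightarrow> norm (F x) \<le> b * norm x"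
    using bop_bound[OF F] by metis
  have "\<exists>g\<in>M. \<forall>x\<in>M. ip K (F x) y = ip H x g" for y
  proof (rule H.riesz[OF M, where b = "b * norm y"])
    fix x assume x: "x \<in> M"
    have "norm (ip K (F x) y) \<le> norm (F x) * norm y" by (rule K.cauchy_schwarz)
    also have "\<dots> \<le> (b * norm x) * norm y" by (intro mult_right_mono b x) simp
    finally show "norm (ip K (F x) y) \<le> b * norm y * norm x" by (simp add: algebra_simps)
  qed (simp_all add: bopD[OF F] K.ip_add_left K.ip_scl_left)
  then obtain g where gM: "\<And>y. g y \<in> M"
    and g: "\<And>x y. x \<in> M \<Longrightarrow> ip K (F x) y = ip H x (g y)" by metis
  have ext: "u = v" if "u \<in> M" "v \<in> M" "\<And>x. x \<in> M \<Longrightarrow> ip H x u = ip H x v" for u v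
  proof -
    have "ip H (u - v) (u - v) = 0"
      using that H.closed_subspace_diff[OF M] by (simp add: H.ip_diff_right)
    then show ?thesis by simp
  qed
  define G where "G y = (if y \<in> N then g y else 0)" for y
  have "G \<in> bop K N H M"
  proof (rule bopI[where b = b])
    fix y z assume "y \<in> N" "z \<in> N"
    moreover have "g (y + z) = g y + g z"
      by (rule ext)
        (auto simp: gM H.closed_subspace_add[OF M] H.ip_add_right K.ip_add_right g[symmetric])
    ultimately show "G (y + z) = G y + G z"
      by (simp add: G_def K.closed_subspace_add[OF N])
  next
    fix c y assume "y \<in> N"
    moreover have "g (scl K c y) = scl H c (g y)"
      by (rule ext)
        (auto simp: gM H.closed_subspace_scl[OF M] H.ip_scl_right K.ip_scl_right g[symmetric])
    ultimately show "G (scl K c y) = scl H c (G y)"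
      by (simp add: G_def K.closed_subspace_scl[OF N])
  next
    fix y assume y: "y \<in> N"
    have "(norm (g y))\<^sup>2 = norm (ip K (F (g y)) y)"
      by (simp add: g[OF gM] H.ip_self norm_power)
    also have "\<dots> \<le> norm (F (g y)) * norm y" by (rule K.cauchy_schwarz)
    also have "\<dots> \<le> (b * norm (g y)) * norm y" by (intro mult_right_mono b gM) simp
    finally have "norm (g y) * norm (g y) \<le> (b * norm y) * norm (g y)"
      by (simp add: power2_eq_square algebra_simps)
    then have "norm (g y) \<le> b * norm y"
      using b0 by (cases "g y = 0") auto
    then show "norm (G y) \<le> b * norm y" using y by (simp add: G_def)
  qed (auto simp: G_def gM)
  then show ?thesis using g by (intro bexI[of _ G]) (auto simp: G_def)
qed

lemma
  assumes H: "hilbert_space H" and K: "hilbert_space K"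
    and M: "closed_subspace H M" and N: "closed_subspace K N"
    and F: "F \<in> bop H M K N"
  shows adj_in_bop: "adj H M K N F \<in> bop K N H M"
    and ip_adj_right: "\<And>x y. x \<in> M \<Longrightarrow> y \<in> N \<Longrightarrow> ip H x (adj H M K N F y) = ip K (F x) y"
    and ip_adj_left: "\<And>x y. x \<in> M \<Longrightarrow> y \<in> N \<Longrightarrow> ip H (adj H M K N F y) x = ip K y (F x)"
proof -
  interpret H: hilbert_space H by (rule H)
  interpret K: hilbert_space K by (rule K)
  define P where "P G \<longleftrightarrow> G \<in> bop K N H M \<and> (\<forall>x\<in>M. \<forall>y\<in>N. ip K (F x) y = ip H x (G y))" for G
  have uniq: "G = G'" if "P G" "P G'" for G G'
  proof
    have G: "G \<in> bop K N H M" "G' \<in> bop K N H M" using that by (auto simp: P_def)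
    fix y show "G y = G' y"
    proof (cases "y \<in> N")
      case True
      have d: "G y - G' y \<in> M"
        by (intro H.closed_subspace_diff[OF M] bop_in[OF G(1)] bop_in[OF G(2)] True)
      have "ip H (G y - G' y) (G y) = ip H (G y - G' y) (G' y)"
        using that d True unfolding P_def by metis
      then have "ip H (G y - G' y) (G y - G' y) = 0" by (simp only: H.ip_diff_right right_minus_eq)
      then show ?thesis by simp
    next
      case False
      then show ?thesis by (simp only: bop_off[OF G(1) False] bop_off[OF G(2) False])
    qed
  qed
  have "\<exists>G. P G" using adjoint_exists[OF assms] unfolding P_def Bex_def .
  then have "\<exists>!G. P G" using uniq by (rule ex_ex1I)
  then have P: "P (adj H M K N F)"
    unfolding adj_def P_def by (rule theI')
  then show "adj H M K N F \<in> bop K N H M" unfolding P_def by (rule conjunct1)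
  fix x y assume xy: "x \<in> M" "y \<in> N"
  have "\<forall>x\<in>M. \<forall>y\<in>N. ip K (F x) y = ip H x (adj H M K N F y)"
    using P unfolding P_def by (rule conjunct2)
  then show right: "ip H x (adj H M K N F y) = ip K (F x) y" using xy by (metis (no_types))
  have "ip H (adj H M K N F y) x = conjg (ip H x (adj H M K N F y))" by (rule H.ip_commute)
  also have "\<dots> = ip K y (F x)" unfolding right by (rule K.ip_commute[symmetric])
  finally show "ip H (adj H M K N F y) x = ip K y (F x)" .
qed

section \<open>The Schur complement from an arbitrary solution\<close>

text \<open>The difference of two solutions of \<open>F = G X\<close> takes values in the null space of \<open>G\<close>. So
  subtracting from any bounded solution its component in that null space yields a reduced
  solution, bounded because projections are contractions; and two reduced solutions differ by
  vectors that lie in the null space and are orthogonal to it, hence agree.\<close>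

lemma douglas_reduced_eq:
  assumes J: "hilbert_space J" and H: "hilbert_space H" and K: "hilbert_space K"
    and L: "closed_subspace J L" and M: "closed_subspace H M"
    and G: "G \<in> bop H M K N"
    and X: "X \<in> bop J L H M" and FX: "\<And>x. x \<in> L \<Longrightarrow> F x = G (X x)"
  shows "douglas_reduced J L H M F G = (\<lambda>x. X x - proj H (null_space M G) (X x))"
proof -
  interpret J: hilbert_space J by (rule J)
  interpret H: hilbert_space H by (rule H)
  note mem = H.closed_subspace_intros[OF M]
  define P where "P = proj H (null_space M G)"
  define Z where "Z x = X x - P (X x)" for x
  have U: "closed_subspace H (null_space M G)"
    by (rule closed_subspace_null_space[OF H K M G])
  have Pn: "P x \<in> M" "G (P x) = 0" for x
    using H.proj_in[OF U, of x] by (auto simp: null_space_def P_def)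
  have GZ: "F x = G (Z x)" if "x \<in> L" for x
    using that by (simp add: Z_def bop_diff[OF H M G] bop_in[OF X] Pn FX)
  have Zorth: "Z x \<in> orth H (null_space M G)" for x
    unfolding Z_def P_def by (rule H.diff_proj_orth[OF U])
  obtain b where b: "\<And>x. x \<in> L \<Longrightarrow> norm (X x) \<le> b * norm x" using bop_bound[OF X] by metis
  have Zbop: "Z \<in> bop J L H M"
  proof (rule bopI[where b = b])
    fix x assume x: "x \<in> L"
    show "norm (Z x) \<le> b * norm x"
      unfolding Z_def P_def using H.norm_diff_proj_le[OF U] b[OF x] by (rule order_trans)
    show "Z x \<in> M" unfolding Z_def by (intro mem Pn bop_in[OF X] x)
    show "Z (scl J c x) = scl H c (Z x)" for c
      using x by (simp add: Z_def P_def bopD[OF X] H.proj_scl[OF U] H.scale_right_diff_distrib)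
    show "Z (x + y) = Z x + Z y" if "y \<in> L" for y
      using x that by (simp add: Z_def P_def bopD[OF X] H.proj_add[OF U])
  next
    fix x assume "x \<notin> L"
    then show "Z x = 0"
      by (simp add: Z_def P_def bop_off[OF X] H.proj_id[OF U H.closed_subspace_0[OF U]])
  qed
  have "douglas_reduced J L H M F G = Z"
    unfolding douglas_reduced_def
  proof (rule the_equality)
    fix V assume V: "V \<in> bop J L H M \<and> (\<forall>x\<in>L. F x = G (V x)) \<and> V ` L \<subseteq> orth H (null_space M G)"
    show "V = Z"
    proof
      fix x show "V x = Z x"
      proof (cases "x \<in> L")
        case True
        have VM: "V x \<in> M" and ZM: "Z x \<in> M" using V True bop_in[OF Zbop] by (auto simp: bop_in)
        have "G (V x - Z x) = 0"
          using V True GZ[OF True] by (simp add: bop_diff[OF H M G VM ZM])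
        then have "V x - Z x \<in> null_space M G" using VM ZM mem by (simp add: null_space_def)
        moreover have "V x - Z x \<in> orth H (null_space M G)"
          using V True Zorth[of x] H.closed_subspace_diff[OF H.closed_subspace_orth] by blast
        ultimately show ?thesis using H.orth_Int by fastforce
      next
        case False
        then show ?thesis using V Zbop by (metis bop_off)
      qed
    qed
  qed (use Zbop GZ Zorth in auto)
  then show ?thesis by (simp add: Z_def P_def fun_eq_iff)
qed

text \<open>For \<open>u\<close> in the null space of \<open>D\<close>, the squared norm of \<open>B u\<close> is the inner product of \<open>u\<close> with
  \<open>B\<^sup>* (B u)\<close>. That vector is also of the form \<open>D\<^sup>* w\<close>, and moving \<open>D\<^sup>*\<close> back onto \<open>u\<close> gives zero.\<close>

lemma null_space_mono_of_adj_range: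
  assumes H: "hilbert_space H" and K: "hilbert_space K"
    and M: "closed_subspace H M" and N: "closed_subspace K N" and N': "closed_subspace K N'"
    and B: "B \<in> bop H M K N" and D: "D \<in> bop H M K N'"
    and ran: "adj H M K N B ` N \<subseteq> adj H M K N' D ` N'"
  shows "null_space M D \<subseteq> null_space M B"
proof
  interpret K: hilbert_space K by (rule K)
  fix u assume "u \<in> null_space M D"
  then have u: "u \<in> M" "D u = 0" by (auto simp: null_space_def)
  have Bu: "B u \<in> N" by (rule bop_in[OF B u(1)])
  then obtain w where w: "w \<in> N'" "adj H M K N B (B u) = adj H M K N' D w" using ran by blast
  have "ip K (B u) (B u) = ip H u (adj H M K N B (B u))"
    by (rule ip_adj_right[OF H K M N B u(1) Bu, symmetric])
  also have "\<dots> = ip K (D u) w"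
    unfolding w(2) by (rule ip_adj_right[OF H K M N' D u(1) w(1)])
  finally show "u \<in> null_space M B" using u by (simp add: null_space_def)
qed

text \<open>Any solution \<open>X\<close> of \<open>C = D X\<close> may replace the reduced one in \<open>A - B Z\<close>, because \<open>X - Z\<close>
  takes values in the null space of \<open>D\<close>, which \<open>B\<close> annihilates.\<close>

lemma schur_complement_eq:
  assumes H: "hilbert_space H" and K: "hilbert_space K"
    and M: "closed_subspace H M" and N: "closed_subspace K N"
    and T: "T \<in> bop H UNIV K UNIV" and compl: "complementable H M K N T"
    and X: "X \<in> bop H M H (orth H M)"
    and CX: "\<forall>x\<in>M. block M K (orth K N) T x = block (orth H M) K (orth K N) T (X x)"
    and x: "x \<in> M"
  shows "schur_complement H M K N T x = block M K N T x - block (orth H M) K N T (X x)"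
proof -
  interpret H: hilbert_space H by (rule H)
  interpret K: hilbert_space K by (rule K)
  let ?B = "block (orth H M) K N T" and ?D = "block (orth H M) K (orth K N) T"
  note Mo = H.closed_subspace_orth[of M] and No = K.closed_subspace_orth[of N]
  have B: "?B \<in> bop H (orth H M) K N" by (rule block_in_bop[OF H K Mo N T])
  have D: "?D \<in> bop H (orth H M) K (orth K N)" by (rule block_in_bop[OF H K Mo No T])
  have U: "closed_subspace H (null_space (orth H M) ?D)"
    by (rule closed_subspace_null_space[OF H K Mo D])
  have "proj H (null_space (orth H M) ?D) (X x) \<in> null_space (orth H M) ?B"
    using null_space_mono_of_adj_range[OF H K Mo N No B D] compl H.proj_in[OF U]
    by (auto simp: complementable_def Let_def)
  then have "?B (X x - proj H (null_space (orth H M) ?D) (X x)) = ?B (X x)"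
    using bop_in[OF X x] by (simp add: null_space_def bop_diff[OF H Mo B])
  then show ?thesis
    using douglas_reduced_eq[OF H H K M Mo D X, of "block M K (orth K N) T"] CX x
    by (simp add: schur_complement_def Let_def H.proj_id[OF M])
qed

section \<open>Comparing the two norms\<close>

text \<open>Polarization, uniformly over the real and the complex scalars: if \<open>h x y\<close> is the difference
  of the two inner products, then \<open>h\<close> is hermitian and vanishes on the diagonal, so \<open>h x y\<close> plus
  its conjugate is zero; replacing \<open>y\<close> by \<open>h x y\<close> times \<open>y\<close> turns this sum into twice the squared
  modulus of \<open>h x y\<close>.\<close>

lemma ip_eq_of_norm_eq:
  fixes H :: "('k::real_or_complex, 'h::banach) inner_space"
  assumes H: "hilbert_space H" and K: "hilbert_space K" and K': "hilbert_space K'"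
    and M: "closed_subspace H M" and F: "F \<in> bop H M K N" and G: "G \<in> bop H M K' N'"
    and eq: "\<And>x. x \<in> M \<Longrightarrow> norm (F x) = norm (G x)" and x: "x \<in> M" and y: "y \<in> M"
  shows "ip K (F x) (F y) = ip K' (G x) (G y)"
proof -
  interpret H: hilbert_space H by (rule H)
  interpret K: hilbert_space K by (rule K)
  interpret K': hilbert_space K' by (rule K')
  note mem = H.closed_subspace_intros[OF M]
  define h where "h x y = ip K (F x) (F y) - ip K' (G x) (G y)" for x y
  have diag: "h z z = 0" if "z \<in> M" for z
    using eq[OF that] by (simp add: h_def K.ip_self K'.ip_self)
  have antisym: "h x z + conjg (h x z) = 0" if z: "z \<in> M" for z
  proof -
    have "h (x + z) (x + z) = h x x + h x z + h z x + h z z"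
      using x z by (simp add: h_def bopD[OF F] bopD[OF G] K.ip_add_left K.ip_add_right
          K'.ip_add_left K'.ip_add_right)
    moreover have "h z x = conjg (h x z)"
      unfolding h_def conjg_diff by (metis K.ip_commute K'.ip_commute)
    ultimately show ?thesis using diag x z mem by simp
  qed
  define c where "c = h x y"
  have "h x (scl H c y) = conjg c * h x y"
    using y by (simp add: h_def bopD[OF F] bopD[OF G] K.ip_scl_right K'.ip_scl_right
        right_diff_distrib)
  then have "h x (scl H c y) = of_real ((norm c)\<^sup>2)"
    by (metis c_def mult.commute mult_conjg_of_real)
  then have "(of_real ((norm c)\<^sup>2 + (norm c)\<^sup>2) :: 'k) = of_real 0"
    using antisym[OF mem(4)[OF y], of c] by (metis conjg_of_real of_real_add of_real_0)
  then have "c = 0" unfolding of_real_eq_iff by simp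
  then show ?thesis by (simp add: c_def h_def)
qed

theorem theorem3p1:
  fixes H1 :: "('k::real_or_complex, 'a::banach) inner_space"
    and H2 :: "('k, 'b::banach) inner_space"
    and M :: "'a set" and N :: "'b set"
    and T A B C D S :: "'a \<Rightarrow> 'b" and X :: "'a \<Rightarrow> 'a"
    and A' B' C' S' :: "'b \<Rightarrow> 'a" and X' :: "'a \<Rightarrow> 'a"
    and W :: "'a \<Rightarrow> 'a"
  assumes "hilbert_space H1" and "hilbert_space H2"
    and "closed_subspace H1 M" and "closed_subspace H2 N"
    and "T \<in> bop H1 UNIV H2 UNIV"
    and "A = block M H2 N T"
    and "B = block (orth H1 M) H2 N T"
    and "C = block M H2 (orth H2 N) T"
    and "D = block (orth H1 M) H2 (orth H2 N) T"
    and "complementable H1 M H2 N T"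
    and "X \<in> bop H1 M H1 (orth H1 M)" and "\<forall>x\<in>M. C x = D (X x)"
    and "S = (\<lambda>x. if x \<in> M then schur_complement H1 M H2 N T x else 0)"
    and "A' = adj H1 M H2 N A"
    and "B' = adj H1 (orth H1 M) H2 N B"
    and "C' = adj H1 M H2 (orth H2 N) C"
    and "X' = adj H1 M H1 (orth H1 M) X"
    and "S' = adj H1 M H2 N S"
    and "W = (\<lambda>x. C' (C x) + X' (B' (A x)) + A' (B (X x)) - X' (B' (B (X x))))"
  shows
    "(((\<forall>x\<in>M. norm (T x) \<ge> norm (schur_complement H1 M H2 N T x)) \<longleftrightarrow>
          op_le H1 M (\<lambda>x. 0) W) \<and>
      (op_le H1 M (\<lambda>x. 0) W \<longleftrightarrow>
          op_le H1 M (\<lambda>x. S' (S x)) (\<lambda>x. C' (C x) + A' (A x)))) \<and>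
     (((\<forall>x\<in>M. norm (T x) \<le> norm (schur_complement H1 M H2 N T x)) \<longleftrightarrow>
          op_le H1 M W (\<lambda>x. 0)) \<and>
      (op_le H1 M W (\<lambda>x. 0) \<longleftrightarrow>
          op_le H1 M (\<lambda>x. C' (C x) + A' (A x)) (\<lambda>x. S' (S x)))) \<and>
     (((\<forall>x\<in>M. norm (T x) = norm (schur_complement H1 M H2 N T x)) \<longleftrightarrow>
          (\<forall>x\<in>M. W x = 0)) \<and>
      ((\<forall>x\<in>M. W x = 0) \<longleftrightarrow>
          (\<forall>x\<in>M. C' (C x) + A' (A x) = S' (S x))))"
proof -
  interpret H: hilbert_space H1 by fact
  interpret K: hilbert_space H2 by fact
  note HK = assms(1,2) and M = assms(3) and N = assms(4) and T = assms(5)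
  note Mo = H.closed_subspace_orth[of M] and No = K.closed_subspace_orth[of N]
  note mem = H.closed_subspace_intros[OF M]
  note X = assms(11)
  have A: "A \<in> bop H1 M H2 N" and B: "B \<in> bop H1 (orth H1 M) H2 N"
    and C: "C \<in> bop H1 M H2 (orth H2 N)"
    unfolding assms(6-8) by (intro block_in_bop HK M N Mo No T)+
  have S_eq: "S x = A x - B (X x)" if "x \<in> M" for x
    using schur_complement_eq[OF HK M N T assms(10) X _ that] assms(6-9,12,13) that by simp
  have S: "S \<in> bop H1 M H2 N"
  proof -
    obtain a where a: "\<And>x. x \<in> M \<Longrightarrow> norm (A x) \<le> a * norm x" using bop_bound[OF A] by metis
    obtain b where b0: "b \<ge> 0" and b: "\<And>x. x \<in> orth H1 M \<Longrightarrow> norm (B x) \<le> b * norm x"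
      using bop_bound[OF B] by metis
    obtain c where c: "\<And>x. x \<in> M \<Longrightarrow> norm (X x) \<le> c * norm x" using bop_bound[OF X] by metis
    show ?thesis
    proof (rule bopI[where b = "a + b * c"])
      fix x assume x: "x \<in> M"
      have "norm (S x) \<le> norm (A x) + norm (B (X x))"
        unfolding S_eq[OF x] by (rule norm_triangle_ineq4)
      also have "\<dots> \<le> a * norm x + b * norm (X x)"
        by (intro add_mono a b x bop_in[OF X])
      also have "b * norm (X x) \<le> b * (c * norm x)" by (intro mult_left_mono c x b0)
      finally show "norm (S x) \<le> (a + b * c) * norm x" by (simp add: algebra_simps)
    next
      show "S x = 0" if "x \<notin> M" for x using that by (simp add: assms(13))
    qed (simp_all only: S_eq bopD[OF A] bopD[OF B] bopD[OF X] mem K.closed_subspace_intros[OF N]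
        K.scale_right_diff_distrib add_diff_add)
  qed
  note right = ip_adj_right[OF HK M N A, folded assms(14)]
    ip_adj_right[OF HK Mo N B, folded assms(15)] ip_adj_right[OF HK M No C, folded assms(16)]
    ip_adj_right[OF HK(1) HK(1) M Mo X, folded assms(17)] ip_adj_right[OF HK M N S, folded assms(18)]
  note left = ip_adj_left[OF HK M N A, folded assms(14)]
    ip_adj_left[OF HK Mo N B, folded assms(15)] ip_adj_left[OF HK M No C, folded assms(16)]
    ip_adj_left[OF HK(1) HK(1) M Mo X, folded assms(17)] ip_adj_left[OF HK M N S, folded assms(18)]
  note range = bop_in[OF A] bop_in[OF B] bop_in[OF C] bop_in[OF X] bop_in[OF S]
    adj_in_bop[OF HK M N A, folded assms(14), THEN bop_in]
    adj_in_bop[OF HK Mo N B, folded assms(15), THEN bop_in]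
    adj_in_bop[OF HK M No C, folded assms(16), THEN bop_in]
    adj_in_bop[OF HK(1) HK(1) M Mo X, folded assms(17), THEN bop_in]
    adj_in_bop[OF HK M N S, folded assms(18), THEN bop_in]
  have W_M: "W x \<in> M" if "x \<in> M" for x
    unfolding assms(19) by (intro mem range that)
  have ip_W: "ip H1 (W x) y = ip H2 (C x) (C y) + ip H2 (A x) (A y) - ip H2 (S x) (S y)"
    if x: "x \<in> M" and y: "y \<in> M" for x y
    using x y by (simp add: assms(19) S_eq H.ip_add_left H.ip_diff_left K.ip_diff_left
        K.ip_diff_right left range)
  \<comment> \<open>Both sides have the same sesquilinear form on \<open>M\<close>, so their difference is orthogonal to itself.\<close>
  have W_eq: "W x = C' (C x) + A' (A x) - S' (S x)" if x: "x \<in> M" for x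
  proof -
    define v where "v = C' (C x) + A' (A x) - S' (S x)"
    have v: "v \<in> M" unfolding v_def by (intro mem range x)
    then have d: "W x - v \<in> M" by (intro mem W_M x)
    have "ip H1 v y = ip H1 (W x) y" if y: "y \<in> M" for y
      using x y by (simp add: v_def ip_W H.ip_add_left H.ip_diff_left left range)
    from this[OF d] have "ip H1 (W x - v) (W x - v) = 0" by (simp add: H.ip_diff_left)
    then show ?thesis by (simp add: v_def)
  qed
  have T_eq: "T x = A x + C x" if "x \<in> M" for x
    using that by (simp add: assms(6,8) block_def K.proj_orth[OF N])
  have ip_T: "ip H2 (T x) (T y) = ip H2 (C x) (C y) + ip H2 (A x) (A y)"
    if "x \<in> M" "y \<in> M" for x y
    using that by (simp add: T_eq K.ip_add_left K.ip_add_right K.orthD[OF range(3) range(1)]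
        K.orthD'[OF range(3) range(1)])
  have W_form: "ip H1 (W x) x = of_real ((norm (T x))\<^sup>2 - (norm (S x))\<^sup>2)" if x: "x \<in> M" for x
    unfolding of_real_diff K.ip_self[symmetric] using x by (simp add: ip_W ip_T)
  have schur: "schur_complement H1 M H2 N T x = S x" if "x \<in> M" for x
    using that by (simp add: assms(13))
  have neg_form: "ip H1 (- W x) x = of_real ((norm (S x))\<^sup>2 - (norm (T x))\<^sup>2)" if "x \<in> M" for x
    by (simp only: H.ip_minus_left W_form[OF that] flip: of_real_minus) simp
  \<comment> \<open>The order asks for some real number equal to the form; embedding the reals in the scalars is
    injective, so that number can only be the difference of squared norms.\<close>
  have nonneg_iff: "(\<exists>r\<ge>0. (of_real q :: 'k) = of_real r) \<longleftrightarrow> 0 \<le> q" for q :: real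
    unfolding of_real_eq_iff by auto
  have pos_iff: "op_le H1 M (\<lambda>x. 0) W \<longleftrightarrow> (\<forall>x\<in>M. norm (S x) \<le> norm (T x))"
    unfolding op_le_def by (simp add: W_form nonneg_iff power_mono_iff del: of_real_diff)
  have neg_iff: "op_le H1 M W (\<lambda>x. 0) \<longleftrightarrow> (\<forall>x\<in>M. norm (T x) \<le> norm (S x))"
    unfolding op_le_def by (simp add: neg_form nonneg_iff power_mono_iff del: of_real_diff)
  have pos_eq: "op_le H1 M (\<lambda>x. 0) W
      \<longleftrightarrow> op_le H1 M (\<lambda>x. S' (S x)) (\<lambda>x. C' (C x) + A' (A x))"
    unfolding op_le_def by (simp add: W_eq)
  have neg_eq: "op_le H1 M W (\<lambda>x. 0)
      \<longleftrightarrow> op_le H1 M (\<lambda>x. C' (C x) + A' (A x)) (\<lambda>x. S' (S x))"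
    unfolding op_le_def by (simp add: W_eq)
  have zero_iff: "(\<forall>x\<in>M. norm (T x) = norm (S x)) \<longleftrightarrow> (\<forall>x\<in>M. W x = 0)"
  proof
    assume eq: "\<forall>x\<in>M. norm (T x) = norm (S x)"
    \<comment> \<open>An operator on \<open>M\<close> vanishes off \<open>M\<close>, hence the truncation of \<open>T\<close>.\<close>
    have TM: "(\<lambda>x. if x \<in> M then T x else 0) \<in> bop H1 M H2 UNIV"
    proof -
      obtain b where "\<And>x. norm (T x) \<le> b * norm x" using bop_bound[OF T] by (metis UNIV_I)
      then show ?thesis by (intro bopI[where b = b]) (auto simp: bopD[OF T] mem)
    qed
    show "\<forall>x\<in>M. W x = 0"
    proof
      fix x assume x: "x \<in> M"
      have "ip H2 (T x) (T (W x)) = ip H2 (S x) (S (W x))"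
        using ip_eq_of_norm_eq[OF HK(1) HK(2) HK(2) M TM S _ x W_M[OF x]] eq x W_M[OF x] by simp
      then have "ip H1 (W x) (W x) = 0" using x W_M by (simp add: ip_W ip_T)
      then show "W x = 0" by simp
    qed
  next
    assume "\<forall>x\<in>M. W x = 0"
    then have "op_le H1 M (\<lambda>x. 0) W" "op_le H1 M W (\<lambda>x. 0)"
      unfolding op_le_def by auto
    then show "\<forall>x\<in>M. norm (T x) = norm (S x)"
      unfolding pos_iff neg_iff by (auto intro: antisym)
  qed
  have zero_eq: "(\<forall>x\<in>M. W x = 0) \<longleftrightarrow> (\<forall>x\<in>M. C' (C x) + A' (A x) = S' (S x))"
    by (simp add: W_eq)
  show ?thesis
    using pos_iff pos_eq neg_iff neg_eq zero_iff zero_eq schur by simp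
qed

end
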